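(* Let $G=(V,E)$ be a finite connected simple graph with $E\ne\varnothing$ and $\operatorname{girth}(G)\ge 6$. Then $$\kappa_{\max}^{\mathrm{LLY}}(G)=\frac{4}{\operatorname{mad}(G)}-2 .$$ Equivalently, $$\kappa_{\max}^{\mathrm{LLY}}(G)=\min_{\substack{H\subseteq G\text{ connected}\\ E(H)\ne\varnothing}}\frac{2(1-\beta(H))}{|E(H)|},$$ where $\beta(H)=|E(H)|-|V(H)|+1$ is the cycle rank of the connected graph $H$.
   Context: Graphs are finite, simple and undirected. $\operatorname{girth}(G)$ is the length of a shortest cycle of $G$, with $\operatorname{girth}(G)=\infty$ if $G$ is a tree. The maximum average degree is $\operatorname{mad}(G):=\max_{\varnothing\ne H\subseteq G}\frac{2|E(H)|}{|V(H)|}$, the maximum being over nonempty subgraphs $H$ of $G$. Lin--Lu--Yau curvature with fixed combinatorial distance: let $G=(V,E)$ be finite and connected with $E\neq\varnothing$, and let $d$ be its combinatorial (shortest-path) distance. A positive edge weight is a function $w:E\to(0,\infty)$; put $d_x^w:=\sum_{z\sim x}w_{xz}$. For $\alpha\in[0,1]$ and $x\in V$ let $\mu_x^{\alpha,w}$ be the probability measure on $V$ with $\mu_x^{\alpha,w}(x)=\alpha$, $\mu_x^{\alpha,w}(z)=(1-\alpha)w_{xz}/d_x^w$ if $z\sim x$, and $\mu_x^{\alpha,w}(z)=0$ otherwise. Let $W_1$ be the $1$-Wasserstein distance with respect to $d$ (independent of $w$). For an edge $e=xy$, put $\kappa_\alpha^w(x,y):=1-W_1(\mu_x^{\alpha,w},\mu_y^{\alpha,w})$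 and $$\kappa_{\mathrm{LLY}}^w(e)=\kappa_{\mathrm{LLY}}^w(x,y):=\lim_{\alpha\to1^-}\frac{\kappa_\alpha^w(x,y)}{1-\alpha}.$$ Put $\kappa_{\mathrm{LLY}}^w(G):=\min_{e\in E}\kappa_{\mathrm{LLY}}^w(e)$ and $\kappa_{\max}^{\mathrm{LLY}}(G):=\sup_{w:E\to(0,\infty)}\kappa_{\mathrm{LLY}}^w(G)$. *)

theory Defs
  imports "HOL-Probability.Probability_Mass_Function" "HOL-Library.Extended_Nat"
begin

definition simple_graph :: "'a set \<Rightarrow> 'a set set \<Rightarrow> bool" where
  "simple_graph V E \<longleftrightarrow> finite V \<and> (\<forall>e\<in>E. e \<subseteq> V \<and> card e = 2)"

definition subgraph :: "'a set \<Rightarrow> 'a set set \<Rightarrow> 'a set \<Rightarrow> 'a set set \<Rightarrow> bool" where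
  "subgraph VH EH V E \<longleftrightarrow> simple_graph VH EH \<and> VH \<subseteq> V \<and> EH \<subseteq> E"

text \<open>Walks are nonempty vertex lists; the length of a walk is the number of its steps.\<close>

definition walk :: "'a set \<Rightarrow> 'a set set \<Rightarrow> 'a \<Rightarrow> 'a list \<Rightarrow> 'a \<Rightarrow> bool" where
  "walk V E x p y \<longleftrightarrow> p \<noteq> [] \<and> set p \<subseteq> V \<and> hd p = x \<and> last p = y \<and>
     successively (\<lambda>u v. {u, v} \<in> E) p"

definition graph_connected :: "'a set \<Rightarrow> 'a set set \<Rightarrow> bool" where
  "graph_connected V E \<longleftrightarrow> V \<noteq> {} \<and> (\<forall>x\<in>V. \<forall>y\<in>V. \<exists>p. walk V E x p y)"

definition graph_dist :: "'a set \<Rightarrow> 'a set set \<Rightarrow> 'a \<Rightarrow> 'a \<Rightarrow> nat" where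
  "graph_dist V E x y = (LEAST n. \<exists>p. walk V E x p y \<and> length p = Suc n)"

text \<open>A cycle is listed without repeating its first vertex, so its length is that of the list.\<close>

definition graph_cycle :: "'a set \<Rightarrow> 'a set set \<Rightarrow> 'a list \<Rightarrow> bool" where
  "graph_cycle V E c \<longleftrightarrow> 3 \<le> length c \<and> distinct c \<and> set c \<subseteq> V \<and>
     successively (\<lambda>u v. {u, v} \<in> E) c \<and> {last c, hd c} \<in> E"

text \<open>The infimum of the empty set is \<open>\<infinity>\<close>, so acyclic graphs have infinite girth.\<close>

definition girth :: "'a set \<Rightarrow> 'a set set \<Rightarrow> enat" where
  "girth V E = Inf {enat (length c) |c. graph_cycle V E c}"

definition mad :: "'a set \<Rightarrow> 'a set set \<Rightarrow> real" where
  "mad V E = Max {2 * real (card EH) / real (card VH) |VH EH. subgraph VH EH V E \<and> VH \<noteq> {}}"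

definition cycle_rank :: "'a set \<Rightarrow> 'a set set \<Rightarrow> int" where
  "cycle_rank V E = int (card E) - int (card V) + 1"

definition wasserstein1 :: "('a \<Rightarrow> 'a \<Rightarrow> real) \<Rightarrow> 'a pmf \<Rightarrow> 'a pmf \<Rightarrow> real" where
  "wasserstein1 d \<mu> \<nu> =
     (INF \<pi>\<in>{\<pi>. map_pmf fst \<pi> = \<mu> \<and> map_pmf snd \<pi> = \<nu>}.
        measure_pmf.expectation \<pi> (\<lambda>(x, y). d x y))"

definition weighted_degree :: "'a set set \<Rightarrow> ('a set \<Rightarrow> real) \<Rightarrow> 'a \<Rightarrow> real" where
  "weighted_degree E w x = (\<Sum>z | {x, z} \<in> E. w {x, z})"

definition lazy_mass :: "'a set set \<Rightarrow> ('a set \<Rightarrow> real) \<Rightarrow> real \<Rightarrow> 'a \<Rightarrow> 'a \<Rightarrow> real" where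
  "lazy_mass E w \<alpha> x z =
     (if z = x then \<alpha>
      else if {x, z} \<in> E then (1 - \<alpha>) * w {x, z} / weighted_degree E w x
      else 0)"

text \<open>
  \<open>embed_pmf\<close> is meaningful only for nonnegative functions of total mass 1; lemma
  \<open>pmf_lazy_measure\<close> below shows that this is the case whenever \<open>0 \<le> \<alpha> \<le> 1\<close>, the weight is
  positive on the edges and \<open>x\<close> has a neighbour.
\<close>

definition lazy_measure :: "'a set set \<Rightarrow> ('a set \<Rightarrow> real) \<Rightarrow> real \<Rightarrow> 'a \<Rightarrow> 'a pmf" where
  "lazy_measure E w \<alpha> x = embed_pmf (lazy_mass E w \<alpha> x)"

lemma pmf_lazy_measure:
  assumes G: "simple_graph V E" and w: "\<forall>e\<in>E. 0 < w e"
    and \<alpha>: "0 \<le> \<alpha>" "\<alpha> \<le> 1" and y: "{x, y} \<in> E"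
  shows "pmf (lazy_measure E w \<alpha> x) z = lazy_mass E w \<alpha> x z"
proof -
  let ?N = "{z. {x, z} \<in> E}"
  have "?N \<subseteq> V" using G by (auto simp: simple_graph_def)
  then have fin: "finite ?N" using G finite_subset by (auto simp: simple_graph_def)
  have x: "x \<notin> ?N" using G by (auto simp: simple_graph_def)
  have pos: "0 < weighted_degree E w x"
    unfolding weighted_degree_def using fin w y by (intro sum_pos) auto
  have nonneg: "0 \<le> lazy_mass E w \<alpha> x z" for z
    using \<alpha> pos w by (simp add: lazy_mass_def less_imp_le)
  have "(\<Sum>z\<in>?N. lazy_mass E w \<alpha> x z) = (\<Sum>z\<in>?N. (1 - \<alpha>) * w {x, z} / weighted_degree E w x)"
    using x by (intro sum.cong) (auto simp: lazy_mass_def)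
  also have "\<dots> = (1 - \<alpha>) * weighted_degree E w x / weighted_degree E w x"
    unfolding weighted_degree_def by (simp add: sum_distrib_left sum_divide_distrib)
  also have "\<dots> = 1 - \<alpha>" using pos by simp
  finally have total: "(\<Sum>z\<in>insert x ?N. lazy_mass E w \<alpha> x z) = 1"
    using fin x by (simp add: lazy_mass_def)
  have "(\<integral>\<^sup>+z. ennreal (lazy_mass E w \<alpha> x z) \<partial>count_space UNIV)
      = (\<Sum>z\<in>insert x ?N. ennreal (lazy_mass E w \<alpha> x z))"
    using fin by (intro nn_integral_count_space') (auto simp: lazy_mass_def)
  also have "\<dots> = 1" using total nonneg by (subst sum_ennreal) auto
  finally show ?thesis
    unfolding lazy_measure_def using nonneg by (intro pmf_embed_pmf) auto
qed

definition kappa_alpha ::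
  "'a set \<Rightarrow> 'a set set \<Rightarrow> ('a set \<Rightarrow> real) \<Rightarrow> real \<Rightarrow> 'a \<Rightarrow> 'a \<Rightarrow> real" where
  "kappa_alpha V E w \<alpha> x y =
     1 - wasserstein1 (\<lambda>u v. real (graph_dist V E u v))
           (lazy_measure E w \<alpha> x) (lazy_measure E w \<alpha> y)"

definition kappa_LLY ::
  "'a set \<Rightarrow> 'a set set \<Rightarrow> ('a set \<Rightarrow> real) \<Rightarrow> 'a \<Rightarrow> 'a \<Rightarrow> real" where
  "kappa_LLY V E w x y = Lim (at_left 1) (\<lambda>\<alpha>. kappa_alpha V E w \<alpha> x y / (1 - \<alpha>))"

definition kappa_LLY_graph :: "'a set \<Rightarrow> 'a set set \<Rightarrow> ('a set \<Rightarrow> real) \<Rightarrow> real" where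
  "kappa_LLY_graph V E w = Min {kappa_LLY V E w x y |x y. {x, y} \<in> E}"

text \<open>
  An edge weight is a function on all vertex sets of which only the values on \<open>E\<close> matter.
  Since \<open>wasserstein1\<close> of the two measures is at least \<open>1 - 2 * (1 - \<alpha>)\<close> for an edge, the
  supremum is over a set bounded above by 2.
\<close>

definition kappa_max_LLY :: "'a set \<Rightarrow> 'a set set \<Rightarrow> real" where
  "kappa_max_LLY V E = (SUP w\<in>{w. \<forall>e\<in>E. 0 < w e}. kappa_LLY_graph V E w)"

end

theory Submission imports Defs begin

text \<open>
  Write \<open>d\<^sub>v\<close> for the weighted degree and \<open>D = mad(G)/2\<close>, so that every subgraph \<open>H\<close> satisfies
  \<open>|E(H)| \<le> D |V(H)|\<close> and some \<open>H\<close> attains equality.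

  Girth at least 6 makes the union of the closed neighbourhoods of the ends of an edge \<open>xy\<close>
  metrically a tree: neighbours of \<open>x\<close> and of \<open>y\<close> on the two sides are at distance 3.  Mass
  moving from the \<open>x\<close>-side to the \<open>y\<close>-side thus only ever descends along one potential, and the
  transport problem is solved by that potential.  The result is the formula
  \<open>\<kappa>(xy) = 2 (w\<^sub>x\<^sub>y / d\<^sub>x + w\<^sub>x\<^sub>y / d\<^sub>y) - 2\<close> (\<open>kappa_LLY_edge\<close>), and
  everything after it is about the numbers \<open>w\<^sub>e / d\<^sub>v\<close>.

  For the upper bound, sum the formula over the edges of a subgraph \<open>H\<close>: each vertex contributes
  at most \<open>1\<close> to \<open>\<Sum>\<^sub>e \<Sum>\<^sub>v w\<^sub>e / d\<^sub>v\<close>, so the smallest edge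
  curvature is at most \<open>2 |V(H)| / |E(H)| - 2\<close> (\<open>kappa_LLY_graph_le_sparsity\<close>).

  For the lower bound, look for weights of the form \<open>w\<^sub>e = 1 / (a\<^sub>x + a\<^sub>y)\<close> with vertex strengths
  \<open>a > 0\<close>.  If \<open>a\<^sub>x d\<^sub>x \<le> m\<close> at every vertex, that is, if the score
  \<open>\<Sum>\<^sub>z a\<^sub>x / (a\<^sub>x + a\<^sub>z)\<close> of \<open>x\<close> over its neighbours \<open>z\<close> is at most \<open>m\<close>, then every edge has
  \<open>w\<^sub>e / d\<^sub>x + w\<^sub>e / d\<^sub>y \<ge> 1 / m\<close>.  This is the Bradley--Terry model of paired comparisons, and
  as there, suitable strengths \<open>a = exp t\<close> come from an optimum of a likelihood,
  \<open>F(t) = \<Sum>\<^sub>e ln (\<Sum>\<^sub>v exp t\<^sub>v) - m \<Sum>\<^sub>v t\<^sub>v\<close>, whose partial derivatives are score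
  minus \<open>m\<close>.  On \<open>t \<le> 0\<close> the density bound \<open>D < m\<close> makes \<open>F\<close> coercive
  (\<open>sum_Min_edges_le\<close>), hence a minimiser exists; as decreasing a coordinate is always permitted,
  no partial derivative is positive there (\<open>balanced_strengths_exist\<close>).  Letting \<open>m\<close> tend to
  \<open>D\<close> gives \<open>\<kappa>\<^sub>m\<^sub>a\<^sub>x = 2 / D - 2\<close>.

  The second formula replaces the density of all subgraphs by that of the connected ones, since a
  disconnected graph is no denser than its densest component (\<open>density_bound_from_connected\<close>).
\<close>

section \<open>Optimal transport by a potential\<close>

text \<open>
  The common mass \<open>min \<mu> \<nu>\<close> stays put and the two excesses are matched independently of each
  other, so that mass moves only from points where \<open>\<mu>\<close> dominates to points where \<open>\<nu>\<close> dominates.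
\<close>

lemma maximal_coupling:
  fixes \<mu> \<nu> :: "'a pmf"
  assumes fin: "finite (set_pmf \<mu>)" "finite (set_pmf \<nu>)"
  obtains \<pi> where "map_pmf fst \<pi> = \<mu>" "map_pmf snd \<pi> = \<nu>"
    "\<And>u v. (u, v) \<in> set_pmf \<pi> \<Longrightarrow> u = v \<or> pmf \<nu> u < pmf \<mu> u \<and> pmf \<mu> v < pmf \<nu> v"
proof -
  define A where "A = set_pmf \<mu> \<union> set_pmf \<nu>"
  define c where "c u = min (pmf \<mu> u) (pmf \<nu> u)" for u
  define r where "r u = pmf \<mu> u - c u" for u
  define s where "s u = pmf \<nu> u - c u" for u
  define R where "R = sum r A"
  define g where "g = (\<lambda>(u, v). (if u = v then c u else 0) + r u * s v / R)"
  have finA: "finite A" using fin by (simp add: A_def)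
  have sum1: "sum (pmf \<mu>) A = 1" "sum (pmf \<nu>) A = 1"
    using finA by (auto intro!: sum_pmf_eq_1 simp: A_def)
  have Rs: "sum s A = R"
    unfolding R_def r_def s_def using sum1 by (simp add: sum_subtractf)
  have nn: "0 \<le> c u" "0 \<le> r u" "0 \<le> s u" for u
    by (auto simp: c_def r_def s_def)
  have R0: "0 \<le> R" unfolding R_def by (intro sum_nonneg) (simp add: nn)
  have out: "pmf \<mu> u = 0" "pmf \<nu> u = 0" "c u = 0" "r u = 0" "s u = 0" if "u \<notin> A" for u
    using that by (auto simp: A_def set_pmf_iff c_def r_def s_def)
  \<comment> \<open>If the excess mass \<open>R\<close> vanishes, then so do \<open>r\<close> and \<open>s\<close>, and division by \<open>0\<close> does no harm.\<close>
  have rR: "r u * R / R = r u" and sR: "R * s u / R = s u" for u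
  proof -
    have "r u = 0 \<and> s u = 0" if "R = 0"
    proof (cases "u \<in> A")
      case True
      have "sum r A = 0" "sum s A = 0" using that Rs R_def by auto
      with True finA show ?thesis
        using sum_nonneg_eq_0_iff[OF finA, of r] sum_nonneg_eq_0_iff[OF finA, of s] nn by auto
    qed (simp add: out)
    then show "r u * R / R = r u" "R * s u / R = s u" by (cases "R = 0"; simp)+
  qed
  have row: "(\<Sum>v\<in>A. g (u, v)) = pmf \<mu> u" for u
  proof -
    have "(\<Sum>v\<in>A. g (u, v)) = (\<Sum>v\<in>A. if u = v then c u else 0) + r u * R / R"
      by (simp add: g_def sum.distrib sum_distrib_left sum_divide_distrib flip: Rs)
    also have "\<dots> = pmf \<mu> u"
      unfolding rR using finA out[of u] by (cases "u \<in> A") (auto simp: r_def)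
    finally show ?thesis .
  qed
  have col: "(\<Sum>u\<in>A. g (u, v)) = pmf \<nu> v" for v
  proof -
    have "(\<Sum>u\<in>A. g (u, v)) = (\<Sum>u\<in>A. if u = v then c u else 0) + R * s v / R"
      by (simp add: g_def sum.distrib sum_distrib_right sum_divide_distrib R_def)
    also have "\<dots> = pmf \<nu> v"
      unfolding sR using finA out[of v] by (cases "v \<in> A") (auto simp: s_def)
    finally show ?thesis .
  qed
  have gnn: "0 \<le> g p" for p using nn R0 by (cases p) (simp add: g_def)
  have gout: "g p = 0" if "p \<notin> A \<times> A" for p
    using that out by (cases p) (auto simp: g_def)
  have product: "sum g (B \<times> C) = (\<Sum>u\<in>B. \<Sum>v\<in>C. g (u, v))" for B C
    by (simp add: sum.cartesian_product)
  have total: "sum g (A \<times> A) = 1" using row sum1 by (simp add: product)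
  define \<pi> where "\<pi> = embed_pmf g"
  have "(\<integral>\<^sup>+p. ennreal (g p) \<partial>count_space UNIV) = (\<Sum>p\<in>A \<times> A. ennreal (g p))"
    using finA by (intro nn_integral_count_space') (simp_all add: gout)
  also have "\<dots> = 1" using total gnn by (subst sum_ennreal) auto
  finally have pmf\<pi>: "pmf \<pi> p = g p" for p
    unfolding \<pi>_def using gnn by (intro pmf_embed_pmf) auto
  have set\<pi>: "set_pmf \<pi> \<subseteq> A \<times> A" by (metis gout pmf\<pi> set_pmf_iff subsetI)
  have fst: "map_pmf fst \<pi> = \<mu>"
  proof (rule pmf_eqI)
    fix u
    have "pmf (map_pmf fst \<pi>) u = measure \<pi> (fst -` {u} \<inter> set_pmf \<pi>)"
      by (simp add: pmf_map measure_Int_set_pmf)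
    also have "\<dots> = measure \<pi> (({u} \<times> A) \<inter> set_pmf \<pi>)"
      using set\<pi> by (intro arg_cong[where f = "measure \<pi>"]) auto
    also have "\<dots> = (\<Sum>p\<in>{u} \<times> A. g p)"
      using finA by (simp add: measure_Int_set_pmf measure_measure_pmf_finite pmf\<pi>)
    also have "\<dots> = pmf \<mu> u"
      using row[of u] by (simp add: product)
    finally show "pmf (map_pmf fst \<pi>) u = pmf \<mu> u" .
  qed
  have snd: "map_pmf snd \<pi> = \<nu>"
  proof (rule pmf_eqI)
    fix v
    have "pmf (map_pmf snd \<pi>) v = measure \<pi> (snd -` {v} \<inter> set_pmf \<pi>)"
      by (simp add: pmf_map measure_Int_set_pmf)
    also have "\<dots> = measure \<pi> ((A \<times> {v}) \<inter> set_pmf \<pi>)"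
      using set\<pi> by (intro arg_cong[where f = "measure \<pi>"]) auto
    also have "\<dots> = (\<Sum>p\<in>A \<times> {v}. g p)"
      using finA by (simp add: measure_Int_set_pmf measure_measure_pmf_finite pmf\<pi>)
    also have "\<dots> = pmf \<nu> v"
      using col[of v] by (simp add: product)
    finally show "pmf (map_pmf snd \<pi>) v = pmf \<nu> v" .
  qed
  have "u = v \<or> pmf \<nu> u < pmf \<mu> u \<and> pmf \<mu> v < pmf \<nu> v" if "(u, v) \<in> set_pmf \<pi>" for u v
    using that by (auto simp: set_pmf_iff pmf\<pi> g_def r_def s_def c_def min_def split: if_splits)
  with fst snd show ?thesis by (rule that)
qed

text \<open>
  A Kantorovich duality certificate.  The Lipschitz bound between the two supports bounds the cost
  of every coupling from below, and a coupling that leaves the common mass in place uses only the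
  pairs on which this bound is an equality.
\<close>

lemma wasserstein1_eq_potential_difference:
  fixes f :: "'a \<Rightarrow> real"
  assumes fin: "finite (set_pmf \<mu>)" "finite (set_pmf \<nu>)"
    and refl: "\<And>u. u \<in> set_pmf \<mu> \<Longrightarrow> d u u = 0"
    and lip: "\<And>u v. u \<in> set_pmf \<mu> \<Longrightarrow> v \<in> set_pmf \<nu> \<Longrightarrow> f u - f v \<le> d u v"
    and tight: "\<And>u v. pmf \<nu> u < pmf \<mu> u \<Longrightarrow> pmf \<mu> v < pmf \<nu> v \<Longrightarrow> d u v = f u - f v"
  shows "wasserstein1 d \<mu> \<nu> = measure_pmf.expectation \<mu> f - measure_pmf.expectation \<nu> f"
proof -
  let ?\<Pi> = "{\<pi>. map_pmf fst \<pi> = \<mu> \<and> map_pmf snd \<pi> = \<nu>}"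
  let ?cost = "\<lambda>\<pi>. measure_pmf.expectation \<pi> (\<lambda>(x, y). d x y)"
  let ?D = "measure_pmf.expectation \<mu> f - measure_pmf.expectation \<nu> f"
  have supp: "set_pmf \<pi> \<subseteq> set_pmf \<mu> \<times> set_pmf \<nu>" if "\<pi> \<in> ?\<Pi>" for \<pi>
    using that by force
  have finp: "finite (set_pmf \<pi>)" if "\<pi> \<in> ?\<Pi>" for \<pi>
    using supp[OF that] fin by (meson finite_SigmaI finite_subset)
  have diff: "measure_pmf.expectation \<pi> (\<lambda>p. f (fst p) - f (snd p)) = ?D" if "\<pi> \<in> ?\<Pi>" for \<pi>
  proof -
    have "measure_pmf.expectation \<pi> (\<lambda>p. f (fst p) - f (snd p))
        = measure_pmf.expectation \<pi> (\<lambda>p. f (fst p)) - measure_pmf.expectation \<pi> (\<lambda>p. f (snd p))"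
      by (intro Bochner_Integration.integral_diff integrable_measure_pmf_finite finp that)
    also have "\<dots> = measure_pmf.expectation (map_pmf fst \<pi>) f - measure_pmf.expectation (map_pmf snd \<pi>) f"
      by (simp add: integral_map_pmf)
    finally show ?thesis using that by auto
  qed
  have lower: "?D \<le> ?cost \<pi>" if "\<pi> \<in> ?\<Pi>" for \<pi>
    unfolding diff[OF that, symmetric] using supp[OF that] finp[OF that] lip
    by (intro integral_mono_AE integrable_measure_pmf_finite AE_pmfI) auto
  obtain \<pi> where \<pi>: "map_pmf fst \<pi> = \<mu>" "map_pmf snd \<pi> = \<nu>"
    "\<And>u v. (u, v) \<in> set_pmf \<pi> \<Longrightarrow> u = v \<or> pmf \<nu> u < pmf \<mu> u \<and> pmf \<mu> v < pmf \<nu> v"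
    using maximal_coupling[OF fin] by blast
  then have in\<Pi>: "\<pi> \<in> ?\<Pi>" by simp
  have "?cost \<pi> = ?D"
    unfolding diff[OF in\<Pi>, symmetric]
  proof (intro integral_cong_AE AE_pmfI)
    fix p assume p: "p \<in> set_pmf \<pi>"
    then show "(case p of (x, y) \<Rightarrow> d x y) = f (fst p) - f (snd p)"
      using \<pi>(3)[of "fst p" "snd p"] supp[OF in\<Pi>] refl[of "fst p"] tight[of "fst p" "snd p"]
      by (cases p) auto
  qed auto
  moreover have "wasserstein1 d \<mu> \<nu> \<le> ?cost \<pi>"
    unfolding wasserstein1_def using lower in\<Pi>
    by (intro cINF_lower) (auto intro!: bdd_belowI2[of _ ?D])
  moreover have "?D \<le> wasserstein1 d \<mu> \<nu>"
    unfolding wasserstein1_def using lower in\<Pi> by (intro cINF_greatest) auto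
  ultimately show ?thesis by simp
qed

section \<open>Distances around an edge of a graph of girth at least six\<close>

lemma graph_dist_le:
  assumes "walk V E x p y"
  shows "graph_dist V E x y \<le> length p - 1"
  unfolding graph_dist_def using assms by (intro Least_le exI[of _ p]) (auto simp: walk_def)

lemma shortest_walk:
  assumes "graph_connected V E" "x \<in> V" "y \<in> V"
  obtains p where "walk V E x p y" "length p = Suc (graph_dist V E x y)"
proof -
  obtain p where p: "walk V E x p y" using assms by (auto simp: graph_connected_def)
  then have "walk V E x p y \<and> length p = Suc (length p - 1)" by (auto simp: walk_def)
  then have "\<exists>n p. walk V E x p y \<and> length p = Suc n" by blast
  from LeastI_ex[OF this] show ?thesis using that by (auto simp: graph_dist_def)
qed

lemma simple_graph_edge:
  assumes "simple_graph V E" "{x, y} \<in> E"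
  shows "x \<in> V" "y \<in> V" "x \<noteq> y"
  using assms by (auto simp: simple_graph_def)

lemma short_walk_cases:
  assumes G: "simple_graph V E" "graph_connected V E" and "u \<in> V" "v \<in> V"
  obtains "graph_dist V E u v = 0" "u = v"
    | "graph_dist V E u v = 1" "{u, v} \<in> E"
    | t where "graph_dist V E u v = 2" "{u, t} \<in> E" "{t, v} \<in> E"
    | "3 \<le> graph_dist V E u v"
proof -
  obtain p where p: "walk V E u p v" "length p = Suc (graph_dist V E u v)"
    using shortest_walk[OF G(2) assms(3,4)] .
  show ?thesis
  proof (cases "3 \<le> graph_dist V E u v")
    case False
    then consider "graph_dist V E u v = 0" | "graph_dist V E u v = 1" | "graph_dist V E u v = 2"
      by linarith
    then show ?thesis
    proof cases
      case 1
      then show ?thesis using p that(1) by (auto simp: walk_def length_Suc_conv)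
    next
      case 2
      then show ?thesis using p that(2) by (auto simp: walk_def length_Suc_conv)
    next
      case 3
      then show ?thesis using p that(3) by (auto simp: walk_def length_Suc_conv numeral_2_eq_2)
    qed
  qed (rule that(4))
qed

lemma girth_le_cycle:
  assumes "graph_cycle V E c"
  shows "girth V E \<le> enat (length c)"
  unfolding girth_def using assms by (intro Inf_lower) auto

text \<open>
  Written out edge by edge, the absence of 3-, 4- and 5-cycles can be used directly on the
  adjacencies at hand.  For the triangle, distinctness follows from the edges.
\<close>

lemma girth_6_no_short_cycle:
  assumes "simple_graph V E" "girth V E \<ge> 6"
  shows "{a, b} \<in> E \<Longrightarrow> {b, c} \<in> E \<Longrightarrow> {c, a} \<in> E \<Longrightarrow> False"
    and "distinct [a, b, c, d] \<Longrightarrow> {a, b} \<in> E \<Longrightarrow> {b, c} \<in> E \<Longrightarrow> {c, d} \<in> E \<Longrightarrow> {d, a} \<in> E \<Longrightarrow> False"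
    and "distinct [a, b, c, d, e] \<Longrightarrow> {a, b} \<in> E \<Longrightarrow> {b, c} \<in> E \<Longrightarrow> {c, d} \<in> E \<Longrightarrow> {d, e} \<in> E
      \<Longrightarrow> {e, a} \<in> E \<Longrightarrow> False"
proof -
  have no: "\<not> graph_cycle V E c" if "length c < 6" for c
  proof
    assume "graph_cycle V E c"
    from order_trans[OF assms(2) girth_le_cycle[OF this]] have "enat 6 \<le> enat (length c)"
      by (simp add: numeral_eq_enat)
    with that show False by simp
  qed
  note edge = simple_graph_edge[OF assms(1)]
  show "{a, b} \<in> E \<Longrightarrow> {b, c} \<in> E \<Longrightarrow> {c, a} \<in> E \<Longrightarrow> False"
    using no[of "[a, b, c]"] edge[of a b] edge[of b c] edge[of c a] by (auto simp: graph_cycle_def)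
  show "distinct [a, b, c, d] \<Longrightarrow> {a, b} \<in> E \<Longrightarrow> {b, c} \<in> E \<Longrightarrow> {c, d} \<in> E \<Longrightarrow> {d, a} \<in> E \<Longrightarrow> False"
    using no[of "[a, b, c, d]"] edge[of a b] edge[of c d] by (auto simp: graph_cycle_def)
  show "distinct [a, b, c, d, e] \<Longrightarrow> {a, b} \<in> E \<Longrightarrow> {b, c} \<in> E \<Longrightarrow> {c, d} \<in> E \<Longrightarrow> {d, e} \<in> E
      \<Longrightarrow> {e, a} \<in> E \<Longrightarrow> False"
    using no[of "[a, b, c, d, e]"] edge[of a b] edge[of c d] edge[of e a]
    by (auto simp: graph_cycle_def)
qed

text \<open>
  A height function on the tree around \<open>xy\<close>: it falls by 1 with each step of a walk from a
  neighbour of \<open>x\<close> through \<open>x\<close> and \<open>y\<close> to a neighbour of \<open>y\<close>.  The value \<open>-1\<close> is meant for the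
  neighbours of \<open>y\<close>; vertices farther away carry no mass.
\<close>

definition edge_potential :: "'a set set \<Rightarrow> 'a \<Rightarrow> 'a \<Rightarrow> 'a \<Rightarrow> real" where
  "edge_potential E x y u =
     (if u = x then 1 else if u = y then 0 else if {x, u} \<in> E then 2 else -1)"

text \<open>
  The vertices \<open>u\<close> and \<open>v\<close> run through the supports of the measures at \<open>x\<close> and \<open>y\<close>.  A shorter
  connection than the potential permits would close a cycle of length at most 5 with the edge \<open>xy\<close>.
\<close>

lemma edge_potential_le_dist:
  assumes G: "simple_graph V E" "graph_connected V E" "girth V E \<ge> 6" and xy: "{x, y} \<in> E"
    and u: "u = x \<or> {x, u} \<in> E" and v: "v = y \<or> {y, v} \<in> E"
  shows "edge_potential E x y u - edge_potential E x y v \<le> real (graph_dist V E u v)"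
proof -
  note no3 = girth_6_no_short_cycle(1)[OF G(1,3)]
    and no4 = girth_6_no_short_cycle(2)[OF G(1,3)]
    and no5 = girth_6_no_short_cycle(3)[OF G(1,3)]
  note edge = simple_graph_edge[OF G(1)]
  have "u \<in> V" "v \<in> V" using u v xy edge by auto
  from G(1,2) this show ?thesis
  proof (cases rule: short_walk_cases)
    case 1
    then show ?thesis by simp
  next
    case 2
    then show ?thesis
      using u v xy edge[OF xy] edge[OF 2(2)] no3[of x y u] no3[of x y v] no4[of u x y v]
      by (auto simp: edge_potential_def insert_commute)
  next
    case (3 t)
    \<comment> \<open>Potential difference 3 at distance 2 would close the 5-cycle \<open>t, u, x, y, v\<close>.\<close>
    have "\<not> (u \<noteq> x \<and> u \<noteq> y \<and> v \<noteq> y \<and> v \<noteq> x)"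
    proof
      assume *: "u \<noteq> x \<and> u \<noteq> y \<and> v \<noteq> y \<and> v \<noteq> x"
      then have e: "{x, u} \<in> E" "{y, v} \<in> E" using u v by auto
      have "u \<noteq> v" using no3[of x y u] e xy by (auto simp: insert_commute)
      moreover have "t \<noteq> x" using no3[of x y v] 3 e xy by (auto simp: insert_commute)
      moreover have "t \<noteq> y" using no3[of x y u] 3 e xy by (auto simp: insert_commute)
      ultimately show False
        using no5[of t u x y v] 3 e xy * edge[OF xy] edge[OF 3(2)] edge[OF 3(3)]
        by (auto simp: insert_commute)
    qed
    then show ?thesis using 3 edge[OF xy] by (auto simp: edge_potential_def)
  next
    case 4
    then show ?thesis by (auto simp: edge_potential_def)
  qed
qed

text \<open>
  The exclusions \<open>u \<noteq> y\<close> and \<open>v \<noteq> x\<close> matter: from \<open>y\<close> to \<open>x\<close> the potential rises.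
\<close>

lemma edge_potential_eq_dist:
  assumes G: "simple_graph V E" "graph_connected V E" "girth V E \<ge> 6" and xy: "{x, y} \<in> E"
    and u: "u = x \<or> {x, u} \<in> E" "u \<noteq> y" and v: "v = y \<or> {y, v} \<in> E" "v \<noteq> x"
  shows "real (graph_dist V E u v) = edge_potential E x y u - edge_potential E x y v"
proof (rule antisym)
  note edge = simple_graph_edge[OF G(1)]
  have yx: "{y, x} \<in> E" using xy by (simp add: insert_commute)
  have no: "{x, v} \<notin> E" if "v \<noteq> y"
    using girth_6_no_short_cycle(1)[OF G(1,3), of x y v] v xy that by (auto simp: insert_commute)
  \<comment> \<open>The walk \<open>u, x, y, v\<close> without its repeated vertices.\<close>
  define p where "p = (if u = x then [] else [u]) @ [x, y] @ (if v = y then [] else [v])"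
  have "walk V E u p v"
    unfolding walk_def p_def using u v xy yx edge[OF xy] edge[of x u] edge[of y v]
    by (auto simp: insert_commute)
  from graph_dist_le[OF this] have "graph_dist V E u v \<le> length p - 1" .
  moreover have "real (length p - 1) = edge_potential E x y u - edge_potential E x y v"
    using u v no edge[OF xy] by (auto simp: p_def edge_potential_def)
  ultimately show "real (graph_dist V E u v) \<le> edge_potential E x y u - edge_potential E x y v"
    by linarith
qed (rule edge_potential_le_dist[OF G xy u(1) v(1)])

section \<open>The curvature of an edge\<close>

lemma finite_neighbours:
  assumes "simple_graph V E"
  shows "finite {z. {x, z} \<in> E}"
proof (rule finite_subset)
  show "{z. {x, z} \<in> E} \<subseteq> V" using assms by (auto simp: simple_graph_def)
qed (use assms in \<open>simp add: simple_graph_def\<close>)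

lemma finite_edges:
  assumes "simple_graph V E"
  shows "finite E"
  using assms finite_subset[of E "Pow V"] by (auto simp: simple_graph_def)

lemma edge_doubleton:
  assumes "simple_graph V E" "e \<in> E"
  obtains a b where "e = {a, b}" "a \<noteq> b" "a \<in> V" "b \<in> V"
  using assms unfolding simple_graph_def by (metis card_2_iff insert_subset)

lemma weighted_degree_eq_sum_incident:
  assumes "simple_graph V E"
  shows "weighted_degree E w x = (\<Sum>e\<in>{e\<in>E. x \<in> e}. w e)"
proof -
  have "bij_betw (\<lambda>z. {x, z}) {z. {x, z} \<in> E} {e \<in> E. x \<in> e}"
  proof (rule bij_betwI')
    fix e assume e: "e \<in> {e \<in> E. x \<in> e}"
    then obtain a b where "e = {a, b}" using edge_doubleton[OF assms, of e] by blast
    with e have "e = {x, a} \<or> e = {x, b}" by auto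
    with e show "\<exists>z\<in>{z. {x, z} \<in> E}. e = {x, z}" by auto
  qed (auto simp: doubleton_eq_iff)
  from sum.reindex_bij_betw[OF this, of w] show ?thesis by (simp add: weighted_degree_def)
qed

lemma weighted_degree_pos:
  assumes "simple_graph V E" "\<forall>e\<in>E. 0 < w e" "{x, y} \<in> E"
  shows "0 < weighted_degree E w x"
  unfolding weighted_degree_def using finite_neighbours[OF assms(1)] assms(2,3)
  by (intro sum_pos) auto

lemma weight_le_weighted_degree:
  assumes "simple_graph V E" "\<forall>e\<in>E. 0 < w e" "{x, y} \<in> E"
  shows "w {x, y} \<le> weighted_degree E w x"
  unfolding weighted_degree_def using finite_neighbours[OF assms(1)] assms(2,3)
  by (intro member_le_sum[where f = "\<lambda>z. w {x, z}"]) (auto intro: less_imp_le)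

lemma set_pmf_lazy_measure:
  assumes "simple_graph V E" "\<forall>e\<in>E. 0 < w e" "0 \<le> \<alpha>" "\<alpha> \<le> 1" "{x, y} \<in> E"
  shows "set_pmf (lazy_measure E w \<alpha> x) \<subseteq> insert x {z. {x, z} \<in> E}"
  using pmf_lazy_measure[OF assms] by (auto simp: set_pmf_iff lazy_mass_def split: if_splits)

text \<open>
  Stated for functions that are constant on the neighbours of \<open>x\<close> other than \<open>y\<close>, because then
  only the transition probability from \<open>x\<close> to \<open>y\<close> survives; edge potentials are of this kind.
\<close>

lemma expectation_lazy_measure:
  assumes G: "simple_graph V E" and w: "\<forall>e\<in>E. 0 < w e" and \<alpha>: "0 \<le> \<alpha>" "\<alpha> \<le> 1"
    and xy: "{x, y} \<in> E" and f: "\<And>z. {x, z} \<in> E \<Longrightarrow> z \<noteq> y \<Longrightarrow> f z = k"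
  shows "measure_pmf.expectation (lazy_measure E w \<alpha> x) f
    = \<alpha> * f x + (1 - \<alpha>) * (k + w {x, y} / weighted_degree E w x * (f y - k))"
proof -
  let ?N = "{z. {x, z} \<in> E}" and ?d = "weighted_degree E w x"
  have fin: "finite ?N" by (rule finite_neighbours[OF G])
  have x: "x \<notin> ?N" using simple_graph_edge[OF G, of x x] by auto
  have d: "0 < ?d" by (rule weighted_degree_pos[OF G w xy])
  have "measure_pmf.expectation (lazy_measure E w \<alpha> x) f
      = (\<Sum>z\<in>insert x ?N. lazy_mass E w \<alpha> x z * f z)"
    using set_pmf_lazy_measure[OF G w \<alpha> xy] fin
    by (subst integral_measure_pmf[where A = "insert x ?N"])
       (auto simp: pmf_lazy_measure[OF G w \<alpha> xy])
  also have "\<dots> = \<alpha> * f x + (\<Sum>z\<in>?N. (1 - \<alpha>) / ?d * (w {x, z} * f z))"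
    using fin x by (subst sum.insert) (auto simp: lazy_mass_def intro!: sum.cong)
  also have "(\<Sum>z\<in>?N. (1 - \<alpha>) / ?d * (w {x, z} * f z)) = (1 - \<alpha>) / ?d * (\<Sum>z\<in>?N. w {x, z} * f z)"
    by (simp add: sum_distrib_left)
  also have "(\<Sum>z\<in>?N. w {x, z} * f z)
      = (\<Sum>z\<in>?N. w {x, z} * k + (if z = y then w {x, y} * (f y - k) else 0))"
    using f by (intro sum.cong) (auto simp: algebra_simps)
  also have "\<dots> = ?d * k + w {x, y} * (f y - k)"
    using fin xy by (simp add: sum.distrib weighted_degree_def sum_distrib_right)
  finally show ?thesis using d by (simp add: field_simps)
qed

lemma kappa_alpha_edge:
  assumes G: "simple_graph V E" "graph_connected V E" "girth V E \<ge> 6"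
    and w: "\<forall>e\<in>E. 0 < w e" and xy: "{x, y} \<in> E" and \<alpha>: "1 / 2 < \<alpha>" "\<alpha> \<le> 1"
  shows "kappa_alpha V E w \<alpha> x y
    = (1 - \<alpha>) * (2 * (w {x, y} / weighted_degree E w x + w {x, y} / weighted_degree E w y) - 2)"
proof -
  let ?f = "edge_potential E x y"
  have \<alpha>0: "0 \<le> \<alpha>" using \<alpha> by simp
  have yx: "{y, x} \<in> E" using xy by (simp add: insert_commute)
  note edge = simple_graph_edge[OF G(1)]
  note px = pmf_lazy_measure[OF G(1) w \<alpha>0 \<alpha>(2) xy] and py = pmf_lazy_measure[OF G(1) w \<alpha>0 \<alpha>(2) yx]
  note sx = set_pmf_lazy_measure[OF G(1) w \<alpha>0 \<alpha>(2) xy] and sy = set_pmf_lazy_measure[OF G(1) w \<alpha>0 \<alpha>(2) yx]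
  \<comment> \<open>For \<open>\<alpha> > 1/2\<close> the mass staying at a vertex exceeds the mass arriving there from its neighbour.\<close>
  have small: "lazy_mass E w \<alpha> a b < \<alpha>" if "{a, b} \<in> E" for a b
  proof -
    have "(1 - \<alpha>) * (w {a, b} / weighted_degree E w a) \<le> (1 - \<alpha>) * 1"
      using weight_le_weighted_degree[OF G(1) w that] weighted_degree_pos[OF G(1) w that] \<alpha>
      by (intro mult_left_mono) (auto simp: divide_simps)
    then show ?thesis using that edge[OF that] \<alpha> by (auto simp: lazy_mass_def)
  qed
  have "wasserstein1 (\<lambda>u v. real (graph_dist V E u v)) (lazy_measure E w \<alpha> x) (lazy_measure E w \<alpha> y)
      = measure_pmf.expectation (lazy_measure E w \<alpha> x) ?f - measure_pmf.expectation (lazy_measure E w \<alpha> y) ?f"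
  proof (rule wasserstein1_eq_potential_difference)
    show "finite (set_pmf (lazy_measure E w \<alpha> x))" "finite (set_pmf (lazy_measure E w \<alpha> y))"
      using sx sy finite_neighbours[OF G(1)] by (meson finite_insert finite_subset)+
  next
    fix u assume "u \<in> set_pmf (lazy_measure E w \<alpha> x)"
    then have "u \<in> V" using sx edge[OF xy] edge[of x u] by auto
    then have "walk V E u [u] u" by (simp add: walk_def)
    from graph_dist_le[OF this] show "real (graph_dist V E u u) = 0" by simp
  next
    fix u v
    assume "u \<in> set_pmf (lazy_measure E w \<alpha> x)" "v \<in> set_pmf (lazy_measure E w \<alpha> y)"
    then show "?f u - ?f v \<le> real (graph_dist V E u v)"
      using sx sy by (intro edge_potential_le_dist[OF G xy]) auto
  next
    fix u v
    assume u: "pmf (lazy_measure E w \<alpha> y) u < pmf (lazy_measure E w \<alpha> x) u"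
      and v: "pmf (lazy_measure E w \<alpha> x) v < pmf (lazy_measure E w \<alpha> y) v"
    have "u \<in> set_pmf (lazy_measure E w \<alpha> x)" "v \<in> set_pmf (lazy_measure E w \<alpha> y)"
      using u v pmf_nonneg[of "lazy_measure E w \<alpha> y" u] pmf_nonneg[of "lazy_measure E w \<alpha> x" v]
      by (auto simp: set_pmf_iff)
    moreover have "u \<noteq> y" using u small[OF xy] by (auto simp: px py) (simp add: lazy_mass_def)
    moreover have "v \<noteq> x" using v small[OF yx] by (auto simp: px py) (simp add: lazy_mass_def)
    ultimately show "real (graph_dist V E u v) = ?f u - ?f v"
      using sx sy by (intro edge_potential_eq_dist[OF G xy]) auto
  qed
  moreover have "measure_pmf.expectation (lazy_measure E w \<alpha> x) ?f
      = \<alpha> * ?f x + (1 - \<alpha>) * (2 + w {x, y} / weighted_degree E w x * (?f y - 2))"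
    using edge[of x] by (intro expectation_lazy_measure[OF G(1) w \<alpha>0 \<alpha>(2) xy]) (auto simp: edge_potential_def)
  moreover have "measure_pmf.expectation (lazy_measure E w \<alpha> y) ?f
      = \<alpha> * ?f y + (1 - \<alpha>) * (-1 + w {y, x} / weighted_degree E w y * (?f x - (-1)))"
    using edge[of y] girth_6_no_short_cycle(1)[OF G(1,3), of x y] xy
    by (intro expectation_lazy_measure[OF G(1) w \<alpha>0 \<alpha>(2) yx])
       (auto simp: edge_potential_def insert_commute)
  ultimately show ?thesis
    using edge[OF xy] unfolding kappa_alpha_def
    by (simp add: edge_potential_def insert_commute[of y x] algebra_simps)
qed

text \<open>
  The quotient \<open>\<kappa>\<^sub>\<alpha> / (1 - \<alpha>)\<close> is constant for \<open>\<alpha>\<close> close to \<open>1\<close>, so the limit is that constant.  Summing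
  over the ends as a set makes the formula a function of the edge, without reference to an orientation.
\<close>

lemma kappa_LLY_edge:
  assumes G: "simple_graph V E" "graph_connected V E" "girth V E \<ge> 6"
    and w: "\<forall>e\<in>E. 0 < w e" and xy: "{x, y} \<in> E"
  shows "kappa_LLY V E w x y = 2 * (\<Sum>v\<in>{x, y}. w {x, y} / weighted_degree E w v) - 2"
proof -
  let ?k = "2 * (\<Sum>v\<in>{x, y}. w {x, y} / weighted_degree E w v) - 2"
  have "eventually (\<lambda>\<alpha>::real. \<alpha> \<in> {1/2<..<1}) (at_left 1)"
    by (rule eventually_at_left_real) simp
  then have "eventually (\<lambda>\<alpha>. kappa_alpha V E w \<alpha> x y / (1 - \<alpha>) = ?k) (at_left 1)"
    using simple_graph_edge(3)[OF G(1) xy]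
    by (elim eventually_mono) (simp add: kappa_alpha_edge[OF G w xy])
  then have "((\<lambda>\<alpha>. kappa_alpha V E w \<alpha> x y / (1 - \<alpha>)) \<longlongrightarrow> ?k) (at_left 1)"
    by (rule tendsto_eventually)
  then show ?thesis unfolding kappa_LLY_def by (intro tendsto_Lim) auto
qed

section \<open>Curvature is at most the sparsity of any subgraph\<close>

lemma finite_edge_curvatures:
  assumes "simple_graph V E"
  shows "finite {kappa_LLY V E w x y |x y. {x, y} \<in> E}"
proof (rule finite_subset)
  show "{kappa_LLY V E w x y |x y. {x, y} \<in> E} \<subseteq> (\<lambda>(x, y). kappa_LLY V E w x y) ` (V \<times> V)"
    using simple_graph_edge[OF assms] by fast
qed (use assms in \<open>simp add: simple_graph_def\<close>)

lemma kappa_LLY_graph_le_edge: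
  assumes "simple_graph V E" "graph_connected V E" "girth V E \<ge> 6" "\<forall>e\<in>E. 0 < w e" "e \<in> E"
  shows "kappa_LLY_graph V E w \<le> 2 * (\<Sum>v\<in>e. w e / weighted_degree E w v) - 2"
proof -
  obtain x y where e: "e = {x, y}" using edge_doubleton[OF assms(1,5)] by metis
  then have "kappa_LLY_graph V E w \<le> kappa_LLY V E w x y"
    unfolding kappa_LLY_graph_def using assms(5) finite_edge_curvatures[OF assms(1)]
    by (intro Min_le) auto
  then show ?thesis using kappa_LLY_edge[OF assms(1-4), of x y] e assms(5) by simp
qed

lemma kappa_LLY_graph_geI:
  assumes "simple_graph V E" "graph_connected V E" "girth V E \<ge> 6" "\<forall>e\<in>E. 0 < w e" "E \<noteq> {}"
    and "\<And>e. e \<in> E \<Longrightarrow> k \<le> 2 * (\<Sum>v\<in>e. w e / weighted_degree E w v) - 2"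
  shows "k \<le> kappa_LLY_graph V E w"
proof -
  obtain x y where "{x, y} \<in> E" using edge_doubleton[OF assms(1)] assms(5) by (metis ex_in_conv)
  then have "{kappa_LLY V E w x y |x y. {x, y} \<in> E} \<noteq> {}" by blast
  then show ?thesis
    unfolding kappa_LLY_graph_def using finite_edge_curvatures[OF assms(1)] assms(6)
    by (intro Min.boundedI) (auto simp: kappa_LLY_edge[OF assms(1-4)])
qed

text \<open>
  Double counting: summed over the edges of \<open>H\<close>, the transition probabilities at a vertex add up
  to at most \<open>1\<close>, and the minimum over all edges is at most the average over those of \<open>H\<close>.
\<close>

lemma kappa_LLY_graph_le_sparsity:
  assumes G: "simple_graph V E" "graph_connected V E" "girth V E \<ge> 6" and w: "\<forall>e\<in>E. 0 < w e"
    and H: "subgraph VH EH V E" "EH \<noteq> {}"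
  shows "kappa_LLY_graph V E w \<le> 2 * real (card VH) / real (card EH) - 2"
proof -
  let ?d = "weighted_degree E w" and ?k = "kappa_LLY_graph V E w"
  have sH: "simple_graph VH EH" and EH: "EH \<subseteq> E" using H by (auto simp: subgraph_def)
  have fin: "finite VH" "finite EH" "finite E"
    using sH finite_edges[OF sH] finite_edges[OF G(1)] by (auto simp: simple_graph_def)
  have "(\<Sum>e\<in>EH. (?k + 2) / 2) \<le> (\<Sum>e\<in>EH. \<Sum>v\<in>e. w e / ?d v)"
    using kappa_LLY_graph_le_edge[OF G w] EH by (intro sum_mono) force
  also have "\<dots> = (\<Sum>e\<in>EH. \<Sum>v\<in>{v\<in>VH. v \<in> e}. w e / ?d v)"
    using sH by (intro sum.cong refl) (auto simp: simple_graph_def)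
  also have "\<dots> = (\<Sum>v\<in>VH. \<Sum>e\<in>{e\<in>EH. v \<in> e}. w e / ?d v)"
    using fin by (intro sum.swap_restrict)
  also have "\<dots> \<le> (\<Sum>v\<in>VH. 1)"
  proof (rule sum_mono)
    fix v
    have "(\<Sum>e\<in>{e\<in>EH. v \<in> e}. w e) \<le> ?d v"
      unfolding weighted_degree_eq_sum_incident[OF G(1)] using fin EH w
      by (intro sum_mono2) (auto intro: less_imp_le)
    moreover have "0 \<le> ?d v"
      unfolding weighted_degree_eq_sum_incident[OF G(1)] using w
      by (intro sum_nonneg) (auto intro: less_imp_le)
    ultimately have "(\<Sum>e\<in>{e\<in>EH. v \<in> e}. w e) / ?d v \<le> 1"
      by (cases "?d v = 0") (auto simp: divide_le_eq_1)
    then show "(\<Sum>e\<in>{e\<in>EH. v \<in> e}. w e / ?d v) \<le> 1" by (simp add: sum_divide_distrib)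
  qed
  finally have "real (card EH) * ((?k + 2) / 2) \<le> real (card VH)" by simp
  moreover have "0 < real (card EH)" using fin H by (simp add: card_gt_0_iff)
  ultimately show ?thesis by (simp add: field_simps)
qed

section \<open>Balanced vertex strengths\<close>

text \<open>
  The density bound, which is the case where \<open>u\<close> is an indicator function, extends to all
  nonnegative \<open>u\<close> because both sides are additive along the layers \<open>{v. u v \<ge> \<lambda>}\<close> with
  \<open>\<lambda> > 0\<close>: an edge lies in
  the layer at height \<open>\<lambda>\<close> exactly when the minimum of \<open>u\<close> on it is at least \<open>\<lambda>\<close>.  The induction
  removes one layer at a time, the one at the smallest positive value of \<open>u\<close>.
\<close>

lemma sum_Min_edges_le:
  fixes u :: "'a \<Rightarrow> real"
  assumes G: "simple_graph V E"
    and dens: "\<And>S. S \<subseteq> V \<Longrightarrow> real (card {e\<in>E. e \<subseteq> S}) \<le> c * real (card S)"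
    and u: "\<And>v. v \<in> V \<Longrightarrow> 0 \<le> u v"
  shows "(\<Sum>e\<in>E. Min (u ` e)) \<le> c * sum u V"
  using u
proof (induction "card {v\<in>V. u v \<noteq> 0}" arbitrary: u rule: less_induct)
  case less
  define S where "S = {v\<in>V. u v \<noteq> 0}"
  have fin: "finite V" "finite E" using G finite_edges[OF G] by (auto simp: simple_graph_def)
  have S: "finite S" "S \<subseteq> V" using fin by (auto simp: S_def)
  show ?case
  proof (cases "S = {}")
    case True
    then have 0: "u v = 0" if "v \<in> V" for v using that by (auto simp: S_def)
    have "Min (u ` e) = 0" if "e \<in> E" for e
      using that 0 by (auto elim!: edge_doubleton[OF G])
    then show ?thesis using 0 by simp
  next
    case False
    define \<epsilon> where "\<epsilon> = Min (u ` S)"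
    define u' where "u' v = (if v \<in> S then u v - \<epsilon> else u v)" for v
    have \<epsilon>_le: "\<epsilon> \<le> u v" if "v \<in> S" for v using S that by (simp add: \<epsilon>_def)
    have "\<epsilon> \<in> u ` S" unfolding \<epsilon>_def using S False by (intro Min_in) auto
    then obtain z where z: "z \<in> S" "u z = \<epsilon>" by auto
    have "0 < \<epsilon>" using z less.prems[of z] by (auto simp: S_def)
    have "{v\<in>V. u' v \<noteq> 0} \<subset> S" using z by (auto simp: u'_def S_def)
    then have "card {v\<in>V. u' v \<noteq> 0} < card {v\<in>V. u v \<noteq> 0}"
      using S by (auto simp: S_def intro: psubset_card_mono)
    moreover have "0 \<le> u' v" if "v \<in> V" for v
      using that \<epsilon>_le less.prems by (auto simp: u'_def)
    ultimately have IH: "(\<Sum>e\<in>E. Min (u' ` e)) \<le> c * sum u' V" by (rule less.hyps)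
    have "Min (u ` e) = Min (u' ` e) + (if e \<subseteq> S then \<epsilon> else 0)" if eE: "e \<in> E" for e
    proof -
      obtain a b where e: "e = {a, b}" "a \<noteq> b" "a \<in> V" "b \<in> V" by (rule edge_doubleton[OF G eE])
      have "u v = 0" if "v \<in> V" "v \<notin> S" for v using that by (simp add: S_def)
      moreover have "Min (u ` e) = min (u a) (u b)" "Min (u' ` e) = min (u' a) (u' b)"
        using e by auto
      ultimately show ?thesis
        using e less.prems[of a] less.prems[of b] \<epsilon>_le[of a] \<epsilon>_le[of b]
        by (cases "a \<in> S"; cases "b \<in> S") (auto simp: u'_def min_def)
    qed
    then have "(\<Sum>e\<in>E. Min (u ` e)) = (\<Sum>e\<in>E. Min (u' ` e)) + \<epsilon> * real (card {e\<in>E. e \<subseteq> S})"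
      using fin by (simp add: sum.distrib sum.If_cases Int_def)
    also have "\<dots> \<le> c * sum u' V + \<epsilon> * (c * real (card S))"
      using IH dens[OF S(2)] \<open>0 < \<epsilon>\<close> by (intro add_mono mult_left_mono) auto
    also have "sum u V = sum (\<lambda>v. u' v + (if v \<in> S then \<epsilon> else 0)) V"
      by (intro sum.cong) (auto simp: u'_def)
    then have "c * sum u' V + \<epsilon> * (c * real (card S)) = c * sum u V"
      using fin S by (simp add: sum.distrib sum.If_cases Int_absorb1 algebra_simps)
    finally show ?thesis .
  qed
qed

lemma compact_box:
  fixes A :: "'a \<Rightarrow> real set"
  assumes "\<And>v. compact (A v)"
  shows "compact (PiE UNIV A)"
  using assms compactin_PiE[of "\<lambda>_. euclidean" UNIV A]
  by (simp add: euclidean_product_topology)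

text \<open>
  The strengths are \<open>exp t\<close> for a minimiser \<open>t\<close> of \<open>F\<close> on the orthant \<open>t \<le> 0\<close>.  Without this constraint
  there need not be a minimiser, as shifting all coordinates changes \<open>F\<close> linearly.  With it, every
  coordinate can still be decreased, so the partial derivatives at \<open>t\<close> are at most \<open>0\<close>, even for
  coordinates at the boundary \<open>0\<close>.
\<close>

lemma balanced_strengths_exist:
  assumes G: "simple_graph V E"
    and dens: "\<And>S. S \<subseteq> V \<Longrightarrow> real (card {e\<in>E. e \<subseteq> S}) \<le> c * real (card S)" and cm: "c < m"
  obtains a :: "'a \<Rightarrow> real" where "\<And>v. 0 < a v"
    "\<And>x. x \<in> V \<Longrightarrow> (\<Sum>e\<in>{e\<in>E. x \<in> e}. a x / sum a e) \<le> m"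
proof -
  have fin: "finite V" "finite E" using G finite_edges[OF G] by (auto simp: simple_graph_def)
  have fe: "finite e" "e \<noteq> {}" "e \<subseteq> V" if "e \<in> E" for e
    using edge_doubleton[OF G that] by auto
  have Z: "0 < (\<Sum>v\<in>e. exp (t v))" if "e \<in> E" for e and t :: "'a \<Rightarrow> real"
    using fe[OF that] by (intro sum_pos) auto
  define F :: "('a \<Rightarrow> real) \<Rightarrow> real"
    where "F t = (\<Sum>e\<in>E. ln (\<Sum>v\<in>e. exp (t v))) - m * sum t V" for t
  \<comment> \<open>\<open>ln (\<Sum>\<^sub>v exp t\<^sub>v)\<close> is at least the largest \<open>t\<^sub>v\<close>, so the layer inequality applies to \<open>- t\<close>.\<close>
  have coercive: "(m - c) * (\<Sum>v\<in>V. - t v) \<le> F t" if t: "\<And>v. v \<in> V \<Longrightarrow> t v \<le> 0" for t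
  proof -
    have "- ln (\<Sum>v\<in>e. exp (t v)) \<le> Min ((\<lambda>v. - t v) ` e)" if e: "e \<in> E" for e
    proof (intro Min.boundedI)
      fix k assume "k \<in> (\<lambda>v. - t v) ` e"
      then obtain v where v: "v \<in> e" "k = - t v" by auto
      have "ln (exp (t v)) \<le> ln (\<Sum>v\<in>e. exp (t v))"
        using v fe[OF e] by (intro ln_mono member_le_sum) auto
      then show "- ln (\<Sum>v\<in>e. exp (t v)) \<le> k" using v by simp
    qed (use fe[OF e] in auto)
    then have "(\<Sum>e\<in>E. - ln (\<Sum>v\<in>e. exp (t v))) \<le> (\<Sum>e\<in>E. Min ((\<lambda>v. - t v) ` e))"
      by (rule sum_mono)
    also have "\<dots> \<le> c * (\<Sum>v\<in>V. - t v)" using t by (intro sum_Min_edges_le[OF G dens]) auto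
    finally show ?thesis by (simp add: F_def sum_negf algebra_simps)
  qed
  \<comment> \<open>By coercivity, \<open>F\<close> exceeds \<open>F 0\<close> as soon as a coordinate is below \<open>1 - T\<close>; hence a minimiser on
    the box with lower bound \<open>-T\<close> stays away from this artificial boundary.\<close>
  define T where "T = F (\<lambda>_. 0) / (m - c) + 1"
  have "0 \<le> F (\<lambda>_. 0)" using coercive[of "\<lambda>_. 0"] by simp
  then have T: "1 \<le> T" using cm by (simp add: T_def)
  define K :: "('a \<Rightarrow> real) set" where "K = PiE UNIV (\<lambda>v. if v \<in> V then {-T..0} else {0})"
  have K: "t \<in> K \<longleftrightarrow> (\<forall>v\<in>V. -T \<le> t v \<and> t v \<le> 0) \<and> (\<forall>v. v \<notin> V \<longrightarrow> t v = 0)" for t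
    by (auto simp: K_def PiE_iff split: if_splits)
  have "compact K" unfolding K_def by (intro compact_box) auto
  moreover have "continuous_on K F"
    unfolding F_def using Z
    by (intro continuous_intros continuous_on_product_then_coordinatewise) (auto simp: less_imp_neq[symmetric])
  moreover have 0: "(\<lambda>_. 0) \<in> K" using T by (auto simp: K)
  ultimately obtain t where t: "t \<in> K" and min: "\<And>s. s \<in> K \<Longrightarrow> F t \<le> F s"
    using continuous_attains_inf[of K F] by blast
  have interior: "- T < t x" if x: "x \<in> V" for x
  proof -
    have "(m - c) * (- t x) \<le> (m - c) * (\<Sum>v\<in>V. - t v)"
      using cm fin x t by (intro mult_left_mono member_le_sum[where f = "\<lambda>v. - t v"]) (auto simp: K)
    also have "\<dots> \<le> F t" using t by (intro coercive) (auto simp: K)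
    also have "\<dots> \<le> F (\<lambda>_. 0)" using min 0 by blast
    also have "\<dots> = (m - c) * (T - 1)" using cm by (simp add: T_def)
    finally have "- t x \<le> T - 1" using cm by (simp only: mult_le_cancel_left_pos diff_gt_0_iff_gt)
    then show ?thesis by simp
  qed
  have score: "(\<Sum>e\<in>{e\<in>E. x \<in> e}. exp (t x) / (\<Sum>v\<in>e. exp (t v))) \<le> m" if x: "x \<in> V" for x
  proof (rule ccontr)
    \<comment> \<open>A positive partial derivative would allow \<open>F\<close> to be lowered by decreasing \<open>t x\<close>.\<close>
    let ?D = "(\<Sum>e\<in>E. (if x \<in> e then exp (t x) else 0) / (\<Sum>v\<in>e. exp (t v))) - m"
    assume "\<not> ?thesis"
    then have D: "0 < ?D"
      using fin by (simp add: sum.inter_filter if_distrib[of "\<lambda>y. y / _"] cong: if_cong)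
    have *: "((\<lambda>s. exp ((t(x := s)) v)) has_real_derivative (if v = x then exp (t x) else 0)) (at (t x))" for v
      by (auto intro!: derivative_eq_intros)
    then have sum_deriv: "((\<lambda>s. \<Sum>v\<in>e. exp ((t(x := s)) v)) has_real_derivative (if x \<in> e then exp (t x) else 0)) (at (t x))"
      if "e \<in> E" for e
    proof -
      have "((\<lambda>s. \<Sum>v\<in>e. exp ((t(x := s)) v)) has_real_derivative
          (\<Sum>v\<in>e. if v = x then exp (t x) else 0)) (at (t x))"
        using * by (intro DERIV_sum)
      then show ?thesis using fe[OF that] by simp
    qed
    have "((\<lambda>s. ln (\<Sum>v\<in>e. exp ((t(x := s)) v))) has_real_derivative
        (if x \<in> e then exp (t x) else 0) / (\<Sum>v\<in>e. exp (t v))) (at (t x))" if "e \<in> E" for e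
      using DERIV_chain'[OF sum_deriv[OF that] DERIV_ln[OF Z[OF that]]]
      by (simp add: divide_inverse mult.commute)
    then have ln_deriv: "((\<lambda>s. \<Sum>e\<in>E. ln (\<Sum>v\<in>e. exp ((t(x := s)) v))) has_real_derivative
        (\<Sum>e\<in>E. (if x \<in> e then exp (t x) else 0) / (\<Sum>v\<in>e. exp (t v)))) (at (t x))"
      by (intro DERIV_sum)
    have "sum (t(x := s)) V = s + sum t (V - {x})" for s
      using fin x by (subst sum.remove[of V x]) (auto intro!: sum.cong)
    then have "((\<lambda>s. sum (t(x := s)) V) has_real_derivative 1) (at (t x))"
      by (auto intro!: derivative_eq_intros)
    from DERIV_diff[OF ln_deriv DERIV_cmult[OF this, of m]]
    have "((\<lambda>s. F (t(x := s))) has_real_derivative ?D) (at (t x))"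
      unfolding F_def by simp
    from DERIV_pos_inc_left[OF this D] obtain d where d: "0 < d"
      "\<And>h. 0 < h \<Longrightarrow> h < d \<Longrightarrow> F (t(x := t x - h)) < F t" by auto
    define h where "h = min (d / 2) (t x + T)"
    have h: "0 < h" "h < d" "h \<le> t x + T" using d interior[OF x] by (auto simp: h_def)
    then have "t(x := t x - h) \<in> K" using t x by (auto simp: K)
    from min[OF this] d(2)[OF h(1,2)] show False by simp
  qed
  show ?thesis by (rule that[of "\<lambda>v. exp (t v)"]) (use score in auto)
qed

text \<open>
  With \<open>w\<^sub>e\<close> the reciprocal of the total strength of \<open>e\<close>, the score of \<open>v\<close> is \<open>a\<^sub>v d\<^sub>v\<close>.  Bounding it
  by \<open>m\<close> gives \<open>1 / d\<^sub>v \<ge> a\<^sub>v / m\<close>, and these bounds sum over the ends of \<open>e\<close> to \<open>1 / (m w\<^sub>e)\<close>.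
\<close>

lemma kappa_LLY_graph_ge_of_density:
  assumes G: "simple_graph V E" "graph_connected V E" "girth V E \<ge> 6" "E \<noteq> {}"
    and dens: "\<And>S. S \<subseteq> V \<Longrightarrow> real (card {e\<in>E. e \<subseteq> S}) \<le> c * real (card S)" and m: "c < m" "0 < m"
  obtains w where "\<forall>e\<in>E. 0 < w e" "2 / m - 2 \<le> kappa_LLY_graph V E w"
proof -
  obtain a :: "'a \<Rightarrow> real" where a: "\<And>v. 0 < a v"
    and score: "\<And>x. x \<in> V \<Longrightarrow> (\<Sum>e\<in>{e\<in>E. x \<in> e}. a x / sum a e) \<le> m"
    using balanced_strengths_exist[OF G(1) dens m(1)] by blast
  define w where "w e = 1 / sum a e" for e
  have Z: "0 < sum a e" if "e \<in> E" for e
    by (rule edge_doubleton[OF G(1) that]) (simp add: a add_pos_pos)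
  then have w: "\<forall>e\<in>E. 0 < w e" by (simp add: w_def)
  have "2 / m - 2 \<le> 2 * (\<Sum>v\<in>e. w e / weighted_degree E w v) - 2" if e: "e \<in> E" for e
  proof -
    have "1 / m = (\<Sum>v\<in>e. w e * (a v / m))"
      using Z[OF e] by (simp add: w_def flip: sum_distrib_left sum_divide_distrib)
    also have "\<dots> \<le> (\<Sum>v\<in>e. w e * (1 / weighted_degree E w v))"
    proof (intro sum_mono mult_left_mono)
      fix v assume v: "v \<in> e"
      obtain p q where "e = {p, q}" "p \<noteq> q" "p \<in> V" "q \<in> V" by (rule edge_doubleton[OF G(1) e])
      with v have "\<exists>z. e = {v, z} \<and> v \<in> V" by auto
      then obtain z where e': "e = {v, z}" "v \<in> V" by blast
      then have "0 < weighted_degree E w v" using weighted_degree_pos[OF G(1) w] e by simp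
      moreover have "a v * weighted_degree E w v \<le> m"
        using score[OF e'(2)] by (simp add: weighted_degree_eq_sum_incident[OF G(1)] w_def sum_distrib_left)
      ultimately show "a v / m \<le> 1 / weighted_degree E w v" using m by (simp add: field_simps)
    qed (use w e in \<open>auto intro: less_imp_le\<close>)
    finally show ?thesis by simp
  qed
  then have "2 / m - 2 \<le> kappa_LLY_graph V E w" by (rule kappa_LLY_graph_geI[OF G(1-3) w G(4)])
  with w show ?thesis by (rule that)
qed

section \<open>Maximum average degree and connected subgraphs\<close>

lemma finite_subgraphs:
  assumes "simple_graph V E"
  shows "finite {(VH, EH). subgraph VH EH V E}"
proof (rule finite_subset)
  show "{(VH, EH). subgraph VH EH V E} \<subseteq> Pow V \<times> Pow E" by (auto simp: subgraph_def)
  show "finite (Pow V \<times> Pow E)"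
    using assms finite_edges[OF assms] by (simp add: simple_graph_def)
qed

lemma finite_subgraph_values:
  assumes "simple_graph V E"
  shows "finite {f VH EH |VH EH. subgraph VH EH V E \<and> P VH EH}"
proof (rule finite_subset)
  show "{f VH EH |VH EH. subgraph VH EH V E \<and> P VH EH}
      \<subseteq> (\<lambda>(VH, EH). f VH EH) ` {(VH, EH). subgraph VH EH V E}" by blast
qed (intro finite_imageI finite_subgraphs assms)

lemma card_edges_le_mad:
  assumes "simple_graph V E" "subgraph VH EH V E"
  shows "real (card EH) \<le> mad V E / 2 * real (card VH)"
proof (cases "VH = {}")
  case True
  then have "EH = {}" using assms(2) by (fastforce simp: subgraph_def simple_graph_def)
  with True show ?thesis by simp
next
  case False
  then have "2 * real (card EH) / real (card VH) \<le> mad V E"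
    unfolding mad_def using assms
    by (intro Max_ge finite_subgraph_values[where P = "\<lambda>VH EH. VH \<noteq> {}"]) auto
  moreover have "0 < card VH"
    using False assms(2) by (simp add: subgraph_def simple_graph_def card_gt_0_iff)
  ultimately show ?thesis by (simp add: field_simps)
qed

lemma mad_attained:
  assumes "simple_graph V E" "V \<noteq> {}"
  obtains VH EH where "subgraph VH EH V E" "VH \<noteq> {}" "mad V E = 2 * real (card EH) / real (card VH)"
proof -
  let ?M = "{2 * real (card EH) / real (card VH) |VH EH. subgraph VH EH V E \<and> VH \<noteq> {}}"
  have "?M \<noteq> {}" using assms by (auto simp: subgraph_def)
  then have "mad V E \<in> ?M"
    unfolding mad_def
    by (intro Max_in finite_subgraph_values[where P = "\<lambda>VH EH. VH \<noteq> {}"] assms)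
  then show ?thesis using that by blast
qed

lemma walk_snoc:
  assumes "walk V E x p y" "{y, z} \<in> E" "z \<in> V"
  shows "walk V E x (p @ [z]) z"
  using assms by (auto simp: walk_def successively_append_iff)

lemma disconnected_split:
  assumes G: "simple_graph V E" and "V \<noteq> {}" "\<not> graph_connected V E"
  obtains A where "A \<subset> V" "A \<noteq> {}" "\<And>e. e \<in> E \<Longrightarrow> e \<subseteq> A \<or> e \<subseteq> V - A"
proof -
  obtain x y where x: "x \<in> V" and y: "y \<in> V" and no: "\<And>p. \<not> walk V E x p y"
    using assms by (auto simp: graph_connected_def)
  define A where "A = {z\<in>V. \<exists>p. walk V E x p z}"
  have "walk V E x [x] x" using x by (simp add: walk_def)
  then have "x \<in> A" using x by (auto simp: A_def)
  moreover have "y \<notin> A" using no by (simp add: A_def)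
  moreover have "e \<subseteq> A \<or> e \<subseteq> V - A" if eE: "e \<in> E" for e
  proof -
    obtain a b where e: "e = {a, b}" "a \<noteq> b" "a \<in> V" "b \<in> V" by (rule edge_doubleton[OF G eE])
    then have "a \<in> A \<longleftrightarrow> b \<in> A"
      using eE walk_snoc[of V E x _ a b] walk_snoc[of V E x _ b a]
      by (auto simp: A_def insert_commute)
    then show ?thesis using e by auto
  qed
  ultimately show ?thesis using y that[of A] by (auto simp: A_def)
qed

text \<open>
  Both sides are additive over a partition of the vertices that no edge crosses, so a disconnected
  subgraph inherits the bound from its two smaller parts.
\<close>

lemma density_bound_from_connected:
  assumes G: "simple_graph V E" and c: "0 \<le> c"
    and conn: "\<And>VH EH. subgraph VH EH V E \<Longrightarrow> graph_connected VH EH \<Longrightarrow> EH \<noteq> {} \<Longrightarrow>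
      real (card EH) \<le> c * real (card VH)"
    and H: "subgraph VH EH V E"
  shows "real (card EH) \<le> c * real (card VH)"
  using H
proof (induction "card VH" arbitrary: VH EH rule: less_induct)
  case less
  have sH: "simple_graph VH EH" and sub: "VH \<subseteq> V" "EH \<subseteq> E"
    using less.prems by (auto simp: subgraph_def)
  have fin: "finite VH" "finite EH" using sH finite_edges[OF sH] by (auto simp: simple_graph_def)
  show ?case
  proof (cases "EH = {} \<or> graph_connected VH EH")
    case True
    then show ?thesis using conn[OF less.prems] c by (cases "EH = {}") auto
  next
    case False
    then have "VH \<noteq> {}" using sH by (fastforce simp: simple_graph_def)
    then obtain A where A: "A \<subset> VH" "A \<noteq> {}" "\<And>e. e \<in> EH \<Longrightarrow> e \<subseteq> A \<or> e \<subseteq> VH - A"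
      using disconnected_split[OF sH] False by blast
    have bound: "real (card {e\<in>EH. e \<subseteq> B}) \<le> c * real (card B)" if "B \<subset> VH" for B
    proof (rule less.hyps)
      show "card B < card VH" using that fin by (intro psubset_card_mono)
      have "finite B" using that fin finite_subset by blast
      then show "subgraph B {e \<in> EH. e \<subseteq> B} V E"
        using that sH sub by (auto simp: subgraph_def simple_graph_def)
    qed
    have "EH = {e\<in>EH. e \<subseteq> A} \<union> {e\<in>EH. e \<subseteq> VH - A}" using A(3) by blast
    then have "card EH \<le> card {e\<in>EH. e \<subseteq> A} + card {e\<in>EH. e \<subseteq> VH - A}"
      by (metis card_Un_le)
    then have "real (card EH) \<le> real (card {e\<in>EH. e \<subseteq> A}) + real (card {e\<in>EH. e \<subseteq> VH - A})"
      by linarith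
    also have "\<dots> \<le> c * real (card A) + c * real (card (VH - A))"
      using A by (intro add_mono bound) auto
    also have "\<dots> = c * real (card A + card (VH - A))" by (simp add: distrib_left)
    also have "card A + card (VH - A) = card VH"
      using A(1) fin(1) card_Un_disjoint[of A "VH - A"]
      by (metis Diff_disjoint Diff_partition finite_Diff finite_subset psubset_imp_subset)
    finally show ?thesis .
  qed
qed

lemma cycle_rank_ratio_eq_sparsity:
  assumes "finite EH" "EH \<noteq> {}"
  shows "2 * (1 - real_of_int (cycle_rank VH EH)) / real (card EH)
    = 2 * real (card VH) / real (card EH) - 2"
proof -
  have "2 * (1 - real_of_int (cycle_rank VH EH)) = 2 * real (card VH) - 2 * real (card EH)"
    by (simp add: cycle_rank_def)
  moreover have "real (card EH) \<noteq> 0" using assms by simp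
  ultimately show ?thesis by (simp add: diff_divide_distrib)
qed

section \<open>The maximal curvature\<close>

theorem theorem1p1:
  fixes V :: "'a set" and E :: "'a set set"
  assumes "simple_graph V E" and "graph_connected V E" and "E \<noteq> {}" and "girth V E \<ge> 6"
  shows "kappa_max_LLY V E = 4 / mad V E - 2 \<and>
    kappa_max_LLY V E =
      Min {2 * (1 - real_of_int (cycle_rank VH EH)) / real (card EH) |VH EH.
             subgraph VH EH V E \<and> graph_connected VH EH \<and> EH \<noteq> {}}"
proof -
  note G = assms(1,2,4)
  let ?W = "{w. \<forall>e\<in>E. 0 < w e}" and ?D = "mad V E / 2"
  let ?M = "{2 * (1 - real_of_int (cycle_rank VH EH)) / real (card EH) |VH EH.
             subgraph VH EH V E \<and> graph_connected VH EH \<and> EH \<noteq> {}}"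
  have V: "V \<noteq> {}" using assms(2) by (simp add: graph_connected_def)
  have self: "subgraph V E V E" using assms(1) by (simp add: subgraph_def)
  have "0 < card E" using assms(3) finite_edges[OF assms(1)] by (simp add: card_gt_0_iff)
  then have "0 < ?D * real (card V)" using card_edges_le_mad[OF assms(1) self] by simp
  then have D: "0 < ?D" by (simp add: zero_less_mult_iff)
  obtain VD ED where HD: "subgraph VD ED V E" "VD \<noteq> {}" "mad V E = 2 * real (card ED) / real (card VD)"
    by (rule mad_attained[OF assms(1) V])
  have "ED \<noteq> {}" using HD(3) D by auto
  have upper: "kappa_LLY_graph V E w \<le> 2 / ?D - 2" if "w \<in> ?W" for w
    using kappa_LLY_graph_le_sparsity[OF G _ HD(1) \<open>ED \<noteq> {}\<close>, of w] that HD(3) by simp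
  have dens: "real (card {e\<in>E. e \<subseteq> S}) \<le> ?D * real (card S)" if "S \<subseteq> V" for S
  proof (rule card_edges_le_mad[OF assms(1)])
    have "finite S" using that assms(1) finite_subset by (auto simp: simple_graph_def)
    then show "subgraph S {e \<in> E. e \<subseteq> S} V E"
      using that assms(1) by (auto simp: subgraph_def simple_graph_def)
  qed
  have bdd: "bdd_above (kappa_LLY_graph V E ` ?W)" using upper by (intro bdd_aboveI2)
  have "2 / m - 2 \<le> kappa_max_LLY V E" if m: "?D < m" for m
  proof -
    obtain w where w: "\<forall>e\<in>E. 0 < w e" "2 / m - 2 \<le> kappa_LLY_graph V E w"
      using kappa_LLY_graph_ge_of_density[OF G assms(3) dens m] D m by auto
    then have "kappa_LLY_graph V E w \<le> kappa_max_LLY V E"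
      unfolding kappa_max_LLY_def using bdd by (intro cSUP_upper) auto
    with w show ?thesis by simp
  qed
  then have "eventually (\<lambda>m. 2 / m - 2 \<le> kappa_max_LLY V E) (at_right ?D)"
    by (intro eventually_at_right_less[THEN eventually_mono])
  moreover have "((\<lambda>m. 2 / m - 2) \<longlongrightarrow> 2 / ?D - 2) (at_right ?D)"
    using D by (intro tendsto_intros) auto
  ultimately have "2 / ?D - 2 \<le> kappa_max_LLY V E" by (intro tendsto_upperbound) auto
  moreover have "kappa_max_LLY V E \<le> 2 / ?D - 2"
    unfolding kappa_max_LLY_def using upper by (intro cSUP_least) (auto intro!: exI[of _ "\<lambda>_. 1"])
  ultimately have eq: "kappa_max_LLY V E = 2 / ?D - 2" by simp
  have finM: "finite ?M" by (rule finite_subgraph_values[OF assms(1)])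
  have M: "?M \<noteq> {}" using self assms(2,3) by blast
  have M_sparsity: "?M = {2 * real (card VH) / real (card EH) - 2 |VH EH.
      subgraph VH EH V E \<and> graph_connected VH EH \<and> EH \<noteq> {}}"
  proof (intro Collect_cong iff_exI)
    fix r :: real and VH EH
    have "finite EH" if "subgraph VH EH V E" using that finite_edges by (auto simp: subgraph_def)
    then show "r = 2 * (1 - real_of_int (cycle_rank VH EH)) / real (card EH) \<and>
          subgraph VH EH V E \<and> graph_connected VH EH \<and> EH \<noteq> {} \<longleftrightarrow>
        r = 2 * real (card VH) / real (card EH) - 2 \<and>
          subgraph VH EH V E \<and> graph_connected VH EH \<and> EH \<noteq> {}"
      using cycle_rank_ratio_eq_sparsity[of EH VH] by metis
  qed
  have "2 / ?D - 2 \<le> r" if "r \<in> ?M" for r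
  proof -
    obtain VH EH where H: "subgraph VH EH V E" "EH \<noteq> {}" "r = 2 * real (card VH) / real (card EH) - 2"
      using \<open>r \<in> ?M\<close> unfolding M_sparsity by blast
    have "0 < card EH" using H finite_edges by (auto simp: subgraph_def card_gt_0_iff)
    then have "2 / ?D \<le> 2 * real (card VH) / real (card EH)"
      using card_edges_le_mad[OF assms(1) H(1)] D by (simp add: field_simps)
    then show ?thesis using H(3) by simp
  qed
  then have "2 / ?D - 2 \<le> Min ?M" using finM M by (intro Min.boundedI)
  moreover have "Min ?M \<le> 2 / ?D - 2"
  proof -
    \<comment> \<open>The largest density of a connected subgraph, as read off from the smallest sparsity.\<close>
    define c where "c = 2 / (Min ?M + 2)"
    have "0 < 2 / ?D" using D by simp
    then have pos: "0 < Min ?M + 2" using \<open>2 / ?D - 2 \<le> Min ?M\<close> by linarith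
    have "real (card ED) \<le> c * real (card VD)"
    proof (rule density_bound_from_connected[OF assms(1) _ _ HD(1)])
      fix VH EH assume H: "subgraph VH EH V E" "graph_connected VH EH" "EH \<noteq> {}"
      then have "2 * real (card VH) / real (card EH) - 2 \<in> ?M" unfolding M_sparsity by blast
      then have "Min ?M \<le> 2 * real (card VH) / real (card EH) - 2" by (rule Min_le[OF finM])
      moreover have "0 < card EH" using H finite_edges by (auto simp: subgraph_def card_gt_0_iff)
      ultimately show "real (card EH) \<le> c * real (card VH)" using pos by (simp add: c_def field_simps)
    qed (use pos in \<open>simp add: c_def\<close>)
    moreover have "0 < card VD" using HD by (simp add: subgraph_def simple_graph_def card_gt_0_iff)
    ultimately have "real (card ED) / real (card VD) \<le> c" by (simp add: pos_divide_le_eq)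
    then have "?D \<le> c" using HD(3) by simp
    then show ?thesis using pos D by (simp add: c_def field_simps)
  qed
  ultimately show ?thesis using eq by simp
qed

end
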